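(* (Rule of contraposition.) For all formulas $A,B$: if $A\to B\in\mathcal{L}_4$ then ${\sim}B\to{\sim}A\in\mathcal{L}_4$.
   Context: Formulas are built from a countable set of propositional variables using the binary connectives $\lor,\land,\to$ and the unary connective $\sim$. An assertion $A_{ij}$ is a formula $A$ together with an ordered pair of indices $i,j\in\{0,1,2,3\}$. A sequent $\Gamma\Rightarrow\Delta$ is an ordered pair of sets of assertions; commas denote union, and either side may be empty. A 4-proof is a finite sequence of sequents each of which is an Axiom or follows from one or two earlier sequents by a rule below ($\Gamma,\Gamma',\Delta,\Delta'$ are arbitrary sets of assertions, $i,j,k\in\{0,1,2,3\}$): - Axiom: $\Gamma\Rightarrow\Delta$ whenever $\Gamma\cap\Delta\neq\emptyset$. - Cut: from $\Gamma\Rightarrow\Delta,A_{ij}$ and $A_{ij},\Gamma'\Rightarrow\Delta'$ infer $\Gamma,\Gamma'\Rightarrow\Delta,\Delta'$. - Weakening: from $\Gamma\Rightarrow\Delta$ infer $\Gamma,\Gamma'\Rightarrow\Delta,\Delta'$. - $\lor|$: from $\Gamma,A_{ij}\Rightarrow\Delta$ and $\Gamma',B_{ij}\Rightarrow\Delta'$ infer $\Gamma,\Gamma',(A\lor B)_{ij}\Rightarrow\Delta,\Delta'$. - $|\lor$: from $\Gamma\Rightarrow\Delta,A_{ij},B_{ij}$ infer $\Gamma\Rightarrow\Delta,(A\lor B)_{ij}$. - $\land|$: from $\Gamma,A_{ij},B_{ij}\Rightarrow\Delta$ infer $\Gamma,(A\land B)_{ij}\Rightarrow\Delta$. - $|\land$: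 from $\Gamma\Rightarrow\Delta,A_{ij}$ and $\Gamma'\Rightarrow\Delta',B_{ij}$ infer $\Gamma,\Gamma'\Rightarrow\Delta,\Delta',(A\land B)_{ij}$. - ${\sim}|$: from $\Gamma\Rightarrow\Delta,A_{ij}$ infer $\Gamma,({\sim}A)_{ji}\Rightarrow\Delta$. - $|{\sim}$: from $\Gamma,A_{ij}\Rightarrow\Delta$ infer $\Gamma\Rightarrow\Delta,({\sim}A)_{ji}$. - ${\to}|$: from $\Gamma\Rightarrow\Delta,A_{ki}$ and $\Gamma',B_{kj}\Rightarrow\Delta'$ infer $\Gamma,\Gamma',(A\to B)_{ij}\Rightarrow\Delta,\Delta'$. - $|{\to}$: from $\Gamma,A_{ki}\Rightarrow\Delta,B_{kj}$ infer $\Gamma\Rightarrow\Delta,(A\to B)_{ij}$, provided $k\neq i,j$ and $k$ does not occur as a subscript in any assertion of $\Gamma\cup\Delta$. Tarski's relevance logic $\mathcal{L}_4$ is the set of formulas $A$ such that the sequent $\Rightarrow A_{00}$ appears in some 4-proof. *)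

theory Defs
  imports Main "HOL-Library.Countable" "HOL-Library.Numeral_Type"
begin

datatype 'v fm =
    Var 'v
  | Or "'v fm" "'v fm"  (infixr "\<^bold>\<or>" 60)
  | And "'v fm" "'v fm"  (infixr "\<^bold>\<and>" 65)
  | Imp "'v fm" "'v fm"  (infixr "\<^bold>\<rightarrow>" 55)
  | Neg "'v fm"  ("\<^bold>\<sim>_" [70] 70)

(* The four indices 0, 1, 2, 3 are the elements of the four-element type 4;
   its modular arithmetic plays no role. *)
type_synonym index = 4

(* (A, i, j) is the formula A with subscripts i and j, in this order. *)
type_synonym 'v assertion = "'v fm \<times> index \<times> index"

(* The two sides may be arbitrary sets, also infinite ones. *)
type_synonym 'v sequent = "'v assertion set \<times> 'v assertion set"

abbreviation sequent_of :: "'v assertion set \<Rightarrow> 'v assertion set \<Rightarrow> 'v sequent"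
    (infix "\<^bold>\<Rightarrow>" 50)
  where "\<Gamma> \<^bold>\<Rightarrow> \<Delta> \<equiv> (\<Gamma>, \<Delta>)"

definition fresh :: "index \<Rightarrow> 'v assertion set \<Rightarrow> bool" where
  "fresh k \<Gamma> \<longleftrightarrow> (\<forall>(C, p, q) \<in> \<Gamma>. k \<noteq> p \<and> k \<noteq> q)"

(* inference ps s: s is an instance of the conclusion of a rule whose premises are ps
   (no premises for an axiom). Since commas denote union, a principal or side formula may
   also belong to the context sets. *)
inductive inference :: "'v sequent list \<Rightarrow> 'v sequent \<Rightarrow> bool" where
  Axiom: "\<Gamma> \<inter> \<Delta> \<noteq> {} \<Longrightarrow> inference [] (\<Gamma> \<^bold>\<Rightarrow> \<Delta>)"
| Cut: "inference
    [\<Gamma> \<^bold>\<Rightarrow> \<Delta> \<union> {(A, i, j)}, {(A, i, j)} \<union> \<Gamma>' \<^bold>\<Rightarrow> \<Delta>']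
    (\<Gamma> \<union> \<Gamma>' \<^bold>\<Rightarrow> \<Delta> \<union> \<Delta>')"
| Weakening: "inference [\<Gamma> \<^bold>\<Rightarrow> \<Delta>] (\<Gamma> \<union> \<Gamma>' \<^bold>\<Rightarrow> \<Delta> \<union> \<Delta>')"
| OrL: "inference
    [\<Gamma> \<union> {(A, i, j)} \<^bold>\<Rightarrow> \<Delta>, \<Gamma>' \<union> {(B, i, j)} \<^bold>\<Rightarrow> \<Delta>']
    (\<Gamma> \<union> \<Gamma>' \<union> {(A \<^bold>\<or> B, i, j)} \<^bold>\<Rightarrow> \<Delta> \<union> \<Delta>')"
| OrR: "inference
    [\<Gamma> \<^bold>\<Rightarrow> \<Delta> \<union> {(A, i, j), (B, i, j)}]
    (\<Gamma> \<^bold>\<Rightarrow> \<Delta> \<union> {(A \<^bold>\<or> B, i, j)})"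
| AndL: "inference
    [\<Gamma> \<union> {(A, i, j), (B, i, j)} \<^bold>\<Rightarrow> \<Delta>]
    (\<Gamma> \<union> {(A \<^bold>\<and> B, i, j)} \<^bold>\<Rightarrow> \<Delta>)"
| AndR: "inference
    [\<Gamma> \<^bold>\<Rightarrow> \<Delta> \<union> {(A, i, j)}, \<Gamma>' \<^bold>\<Rightarrow> \<Delta>' \<union> {(B, i, j)}]
    (\<Gamma> \<union> \<Gamma>' \<^bold>\<Rightarrow> \<Delta> \<union> \<Delta>' \<union> {(A \<^bold>\<and> B, i, j)})"
| NegL: "inference
    [\<Gamma> \<^bold>\<Rightarrow> \<Delta> \<union> {(A, i, j)}]
    (\<Gamma> \<union> {(\<^bold>\<sim>A, j, i)} \<^bold>\<Rightarrow> \<Delta>)"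
| NegR: "inference
    [\<Gamma> \<union> {(A, i, j)} \<^bold>\<Rightarrow> \<Delta>]
    (\<Gamma> \<^bold>\<Rightarrow> \<Delta> \<union> {(\<^bold>\<sim>A, j, i)})"
| ImpL: "inference
    [\<Gamma> \<^bold>\<Rightarrow> \<Delta> \<union> {(A, k, i)}, \<Gamma>' \<union> {(B, k, j)} \<^bold>\<Rightarrow> \<Delta>']
    (\<Gamma> \<union> \<Gamma>' \<union> {(A \<^bold>\<rightarrow> B, i, j)} \<^bold>\<Rightarrow> \<Delta> \<union> \<Delta>')"
| ImpR: "k \<noteq> i \<Longrightarrow> k \<noteq> j \<Longrightarrow> fresh k (\<Gamma> \<union> \<Delta>) \<Longrightarrow> inference
    [\<Gamma> \<union> {(A, k, i)} \<^bold>\<Rightarrow> \<Delta> \<union> {(B, k, j)}]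
    (\<Gamma> \<^bold>\<Rightarrow> \<Delta> \<union> {(A \<^bold>\<rightarrow> B, i, j)})"

definition four_proof :: "'v sequent list \<Rightarrow> bool" where
  "four_proof S \<longleftrightarrow>
    (\<forall>n < length S. \<exists>ps. set ps \<subseteq> set (take n S) \<and> inference ps (S ! n))"

definition L4 :: "'v fm set" ("\<L>\<^sub>4") where
  "\<L>\<^sub>4 = {A. \<exists>S. four_proof S \<and> ({} \<^bold>\<Rightarrow> {(A, 0, 0)}) \<in> set S}"

end

theory Submission
  imports Defs "HOL-Combinatorics.Transposition"
begin

text \<open>
  Read \<open>A\<^sub>i\<^sub>j\<close> as ``the pair \<open>(i, j)\<close> lies in the relation denoted by \<open>A\<close>''. Then
  \<open>(A \<^bold>\<rightarrow> B)\<^sub>i\<^sub>j\<close> says that \<open>A\<^sub>k\<^sub>i\<close> implies \<open>B\<^sub>k\<^sub>j\<close> for every \<open>k\<close>, and negation complements the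
  converse relation. Reading the right rule for implication and the negation rules backwards,
  \<open>(\<^bold>\<sim>B \<^bold>\<rightarrow> \<^bold>\<sim>A)\<^sub>0\<^sub>0\<close> reduces to the sequent from \<open>A\<^sub>0\<^sub>1\<close> to \<open>B\<^sub>0\<^sub>1\<close>, with \<open>1\<close> as the fresh index.

  The hypothesis \<open>(A \<^bold>\<rightarrow> B)\<^sub>0\<^sub>0\<close> directly yields only sequents from \<open>A\<^sub>k\<^sub>0\<close> to \<open>B\<^sub>k\<^sub>0\<close>, whose second index is
  \<open>0\<close>; the index that varies is on the wrong side. But no rule treats one index differently from
  another, so an injective renaming of the indices turns proofs into proofs
  (\<open>provable_rename\<close>). Exchanging \<open>0\<close> and \<open>1\<close> gives \<open>(A \<^bold>\<rightarrow> B)\<^sub>1\<^sub>1\<close>, and instantiating this at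
  \<open>k = 0\<close> (\<open>provable_detach\<close>) gives the desired sequent.
\<close>

definition provable :: "'v sequent \<Rightarrow> bool" where
  "provable s \<longleftrightarrow> (\<exists>S. four_proof S \<and> s \<in> set S)"

lemma L4_iff_provable: "A \<in> \<L>\<^sub>4 \<longleftrightarrow> provable ({} \<^bold>\<Rightarrow> {(A, 0, 0)})"
  by (simp add: L4_def provable_def)

lemma four_proof_Nil: "four_proof []"
  by (simp add: four_proof_def)

lemma four_proof_append:
  assumes "four_proof S" "four_proof T"
  shows "four_proof (S @ T)"
  unfolding four_proof_def
proof (intro allI impI)
  fix n assume n: "n < length (S @ T)"
  show "\<exists>ps. set ps \<subseteq> set (take n (S @ T)) \<and> inference ps ((S @ T) ! n)"
  proof (cases "n < length S")
    case True
    then show ?thesis using assms(1) by (auto simp: four_proof_def nth_append)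
  next
    case False
    with n have "n - length S < length T" by simp
    with assms(2) obtain ps where "set ps \<subseteq> set (take (n - length S) T)"
      and "inference ps (T ! (n - length S))"
      unfolding four_proof_def by blast
    with False show ?thesis by (auto simp: nth_append)
  qed
qed

lemma four_proof_snoc:
  assumes "four_proof S" "set ps \<subseteq> set S" "inference ps s"
  shows "four_proof (S @ [s])"
  using assms by (auto simp: four_proof_def nth_append less_Suc_eq)

lemma common_four_proof:
  assumes "\<forall>p \<in> set ps. provable p"
  shows "\<exists>S. four_proof S \<and> set ps \<subseteq> set S"
  using assms
proof (induction ps)
  case Nil
  then show ?case using four_proof_Nil by auto
next
  case (Cons p ps)
  then obtain S T where "four_proof S" "set ps \<subseteq> set S" "four_proof T" "p \<in> set T"
    by (auto simp: provable_def)
  then show ?case using four_proof_append[of S T] by (intro exI[of _ "S @ T"]) auto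
qed

lemma provable_inference:
  assumes "inference ps s" "\<forall>p \<in> set ps. provable p"
  shows "provable s"
proof -
  obtain S where "four_proof S" "set ps \<subseteq> set S"
    using common_four_proof[OF assms(2)] by blast
  then have "four_proof (S @ [s])" using assms(1) by (rule four_proof_snoc)
  then show ?thesis unfolding provable_def by (intro exI[of _ "S @ [s]"]) simp
qed

definition rename_assertion :: "(index \<Rightarrow> index) \<Rightarrow> 'v assertion \<Rightarrow> 'v assertion" where
  "rename_assertion f = (\<lambda>(A, i, j). (A, f i, f j))"

definition rename_sequent :: "(index \<Rightarrow> index) \<Rightarrow> 'v sequent \<Rightarrow> 'v sequent" where
  "rename_sequent f = (\<lambda>(\<Gamma>, \<Delta>). (rename_assertion f ` \<Gamma>, rename_assertion f ` \<Delta>))"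

lemma rename_assertion_simp [simp]: "rename_assertion f (A, i, j) = (A, f i, f j)"
  by (simp add: rename_assertion_def)

lemma rename_sequent_simp [simp]:
  "rename_sequent f (\<Gamma> \<^bold>\<Rightarrow> \<Delta>) = (rename_assertion f ` \<Gamma> \<^bold>\<Rightarrow> rename_assertion f ` \<Delta>)"
  by (simp add: rename_sequent_def)

lemma fresh_rename:
  assumes "inj f" "fresh k \<Gamma>"
  shows "fresh (f k) (rename_assertion f ` \<Gamma>)"
  using assms by (force simp: fresh_def inj_eq)

text \<open>
  Injectivity is what preserves the side condition of the right rule for implication: a fresh
  index must not be identified with one that occurs in the conclusion.
\<close>

lemma inference_rename:
  assumes "inj f" "inference ps s"
  shows "inference (map (rename_sequent f) ps) (rename_sequent f s)"
  using assms(2)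
proof cases
  case (Axiom \<Gamma> \<Delta>)
  then have "rename_assertion f ` \<Gamma> \<inter> rename_assertion f ` \<Delta> \<noteq> {}" by blast
  with Axiom show ?thesis by (simp add: inference.Axiom)
next
  case (ImpR k i j \<Gamma> \<Delta> A B)
  then have "f k \<noteq> f i" "f k \<noteq> f j"
    and "fresh (f k) (rename_assertion f ` \<Gamma> \<union> rename_assertion f ` \<Delta>)"
    using fresh_rename[OF assms(1), of k "\<Gamma> \<union> \<Delta>"] assms(1) by (simp_all add: inj_eq image_Un)
  from inference.ImpR[OF this] ImpR show ?thesis by (simp add: image_Un)
qed (simp_all only: list.map rename_sequent_simp rename_assertion_simp image_Un image_insert
      image_empty inference.intros)

lemma four_proof_rename:
  assumes "inj f" "four_proof S"
  shows "four_proof (map (rename_sequent f) S)"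
  unfolding four_proof_def
proof (intro allI impI)
  fix n assume n: "n < length (map (rename_sequent f) S)"
  with assms(2) obtain ps where ps: "set ps \<subseteq> set (take n S)" "inference ps (S ! n)"
    by (auto simp: four_proof_def)
  from ps(1) have "set (map (rename_sequent f) ps) \<subseteq> set (take n (map (rename_sequent f) S))"
    by (auto simp: take_map)
  with inference_rename[OF assms(1) ps(2)] n
  show "\<exists>qs. set qs \<subseteq> set (take n (map (rename_sequent f) S))
      \<and> inference qs (map (rename_sequent f) S ! n)"
    by (intro exI[of _ "map (rename_sequent f) ps"]) simp
qed

lemma provable_rename:
  assumes "inj f" "provable s"
  shows "provable (rename_sequent f s)"
proof -
  from assms(2) obtain S where "four_proof S" "s \<in> set S"
    by (auto simp: provable_def)
  with four_proof_rename[OF assms(1)] show ?thesis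
    unfolding provable_def by (intro exI[of _ "map (rename_sequent f) S"]) simp
qed

lemma provable_identity: "provable ({a} \<^bold>\<Rightarrow> {a})"
  by (rule provable_inference[OF inference.Axiom]) simp_all

text \<open>
  This inverts the right rule for implication, and for every \<open>k\<close>, not only a fresh one: the left
  rule derives the conclusion from the implication itself, which is then cut.
\<close>

lemma provable_detach:
  assumes "provable ({} \<^bold>\<Rightarrow> {(A \<^bold>\<rightarrow> B, i, j)})"
  shows "provable ({(A, k, i)} \<^bold>\<Rightarrow> {(B, k, j)})"
proof -
  have "provable ({(A, k, i)} \<union> {} \<union> {(A \<^bold>\<rightarrow> B, i, j)} \<^bold>\<Rightarrow> {} \<union> {(B, k, j)})"
    by (rule provable_inference[OF inference.ImpL[where k = k]]) (simp add: provable_identity)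
  then have "provable ({(A \<^bold>\<rightarrow> B, i, j)} \<union> {(A, k, i)} \<^bold>\<Rightarrow> {(B, k, j)})"
    by (simp add: insert_commute)
  with assms have "provable ({} \<union> {(A, k, i)} \<^bold>\<Rightarrow> {} \<union> {(B, k, j)})"
    by (intro provable_inference[OF inference.Cut[where A = "A \<^bold>\<rightarrow> B" and i = i and j = j]]) simp
  then show ?thesis by simp
qed

lemma provable_contrapose:
  assumes "provable ({(A, i, j)} \<^bold>\<Rightarrow> {(B, k, l)})"
  shows "provable ({(\<^bold>\<sim>B, l, k)} \<^bold>\<Rightarrow> {(\<^bold>\<sim>A, j, i)})"
proof -
  from assms have "provable ({(A, i, j)} \<union> {(\<^bold>\<sim>B, l, k)} \<^bold>\<Rightarrow> {})"
    by (intro provable_inference[OF inference.NegL]) simp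
  then have "provable ({(\<^bold>\<sim>B, l, k)} \<^bold>\<Rightarrow> {} \<union> {(\<^bold>\<sim>A, j, i)})"
    by (intro provable_inference[OF inference.NegR]) (simp add: insert_commute)
  then show ?thesis by simp
qed

theorem lemma43:
  fixes A B :: "'v::countable fm"
  assumes "A \<^bold>\<rightarrow> B \<in> \<L>\<^sub>4"
  shows "\<^bold>\<sim>B \<^bold>\<rightarrow> \<^bold>\<sim>A \<in> \<L>\<^sub>4"
proof -
  have "provable (rename_sequent (transpose 0 1) ({} \<^bold>\<Rightarrow> {(A \<^bold>\<rightarrow> B, 0, 0)}))"
    using assms by (intro provable_rename) (simp_all add: L4_iff_provable)
  then have "provable ({} \<^bold>\<Rightarrow> {(A \<^bold>\<rightarrow> B, 1, 1)})" by simp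
  then have "provable ({(A, 0, 1)} \<^bold>\<Rightarrow> {(B, 0, 1)})" by (rule provable_detach)
  then have "provable ({(\<^bold>\<sim>B, 1, 0)} \<^bold>\<Rightarrow> {(\<^bold>\<sim>A, 1, 0)})" by (rule provable_contrapose)
  then have "provable ({} \<^bold>\<Rightarrow> {} \<union> {(\<^bold>\<sim>B \<^bold>\<rightarrow> \<^bold>\<sim>A, 0, 0)})"
    by (intro provable_inference[OF inference.ImpR[where k = 1]]) (simp_all add: fresh_def)
  then show ?thesis by (simp add: L4_iff_provable)
qed

end
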